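(* Let $G$ be a graph of order $n$ and let $k=\dim_2(G)$. Then $n\leq k+2^k$.
   Context: All graphs are finite and simple; the order of a graph is its number of vertices. For a graph $G$ and vertices $x,y\in V(G)$, put $a_G(x,y)=0$ if $x=y$, $a_G(x,y)=1$ if $x$ and $y$ are adjacent, and $a_G(x,y)=2$ otherwise. For a set $W=\{w_1,\ldots,w_m\}\subseteq V(G)$ and a vertex $v\in V(G)$, the adjacency representation of $v$ with respect to $W$ is the $m$-vector $r_2(v|W)=(a_G(v,w_1),\ldots,a_G(v,w_m))$. The set $W$ is an adjacency resolving set for $G$ if the vectors $r_2(v|W)$, $v\in V(G)$, are pairwise distinct. The adjacency dimension $\dim_2(G)$ is the minimum cardinality of an adjacency resolving set for $G$. *)

theory Defs
  imports "Graph_Theory.Digraph" "HOL-Library.FuncSet"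
begin

text \<open>A finite simple graph is an instance of the locale \<^locale>\<open>graph\<close>: a finite digraph
  without loops or parallel arcs whose adjacency relation is symmetric. Each edge is thus
  represented by its two opposite arcs.\<close>

definition adj_dist :: "('a, 'b) pre_digraph \<Rightarrow> 'a \<Rightarrow> 'a \<Rightarrow> nat" where
  "adj_dist G x y = (if x = y then 0 else if x \<rightarrow>\<^bsub>G\<^esub> y then 1 else 2)"

text \<open>The vector of length \<open>card W\<close> is indexed by the elements of \<open>W\<close> themselves, so that no
  enumeration of \<open>W\<close> has to be chosen. It is \<open>undefined\<close> outside \<open>W\<close>, hence two
  representations are equal iff they agree in all coordinates from \<open>W\<close>.\<close>

definition adj_rep :: "('a, 'b) pre_digraph \<Rightarrow> 'a set \<Rightarrow> 'a \<Rightarrow> 'a \<Rightarrow> nat" where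
  "adj_rep G W v = (\<lambda>w\<in>W. adj_dist G v w)"

definition adj_resolving :: "('a, 'b) pre_digraph \<Rightarrow> 'a set \<Rightarrow> bool" where
  "adj_resolving G W \<longleftrightarrow> W \<subseteq> verts G \<and> inj_on (adj_rep G W) (verts G)"

definition adj_dim :: "('a, 'b) pre_digraph \<Rightarrow> nat" where
  "adj_dim G = (LEAST k. \<exists>W. adj_resolving G W \<and> card W = k)"

text \<open>The minimum is always over a nonempty set.\<close>

lemma adj_resolving_verts: "adj_resolving G (verts G)"
  unfolding adj_resolving_def
proof (intro conjI subset_refl inj_onI)
  fix x y
  assume x: "x \<in> verts G" and y: "y \<in> verts G"
    and eq: "adj_rep G (verts G) x = adj_rep G (verts G) y"
  from eq have "adj_rep G (verts G) x y = adj_rep G (verts G) y y" by simp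
  with y show "x = y" by (simp add: adj_rep_def adj_dist_def split: if_splits)
qed

end

theory Submission
  imports Defs
begin

text \<open>Take a resolving set \<open>W\<close> of minimum size \<open>k\<close>. A vertex outside
  \<open>W\<close> never has coordinate 0, so its representation is one of the \<open>2 ^ k\<close>
  functions from \<open>W\<close> to {1, 2} (\<open>adj_rep_outside\<close>). Distinct vertices have
  distinct representations, so at most \<open>2 ^ k\<close> vertices lie outside \<open>W\<close>;
  the \<open>k\<close> vertices of \<open>W\<close> complete the count
  (\<open>card_verts_le_adj_resolving\<close>).\<close>

lemma adj_dim_attained:
  obtains W where "adj_resolving G W" and "card W = adj_dim G"
proof -
  have "\<exists>W. adj_resolving G W \<and> card W = adj_dim G"
    unfolding adj_dim_def by (rule LeastI_ex) (use adj_resolving_verts in blast)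
  then show thesis using that by blast
qed

text \<open>The value 0 arises only at the coordinate of the vertex itself; excluding it lowers the
  base of the count from 3 to 2.\<close>

lemma adj_rep_outside: "v \<notin> W \<Longrightarrow> adj_rep G W v \<in> W \<rightarrow>\<^sub>E {1, 2}"
  unfolding adj_rep_def by (rule restrict_PiE_iff[THEN iffD2]) (auto simp: adj_dist_def)

lemma card_verts_le_adj_resolving:
  assumes fin: "finite (verts G)" and W: "adj_resolving G W"
  shows "card (verts G) \<le> card W + 2 ^ card W"
proof -
  have sub: "W \<subseteq> verts G" and inj: "inj_on (adj_rep G W) (verts G)"
    using W by (auto simp: adj_resolving_def)
  have finW: "finite W" using sub fin by (rule finite_subset)
  have "card (verts G - W) \<le> card (W \<rightarrow>\<^sub>E {1, 2 :: nat})"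
  proof (rule card_inj_on_le)
    show "inj_on (adj_rep G W) (verts G - W)"
      using inj by (rule inj_on_subset) blast
    show "adj_rep G W ` (verts G - W) \<subseteq> W \<rightarrow>\<^sub>E {1, 2}"
      using adj_rep_outside by fast
    show "finite (W \<rightarrow>\<^sub>E {1, 2 :: nat})"
      using finW by (intro finite_PiE) auto
  qed
  also have "\<dots> = 2 ^ card W"
    using finW by (simp add: card_PiE numeral_2_eq_2)
  \<comment> \<open>Truncated subtraction is harmless here: on naturals,
    \<open>a - b \<le> c\<close> still yields \<open>a \<le> b + c\<close>.\<close>
  finally show ?thesis
    using card_Diff_subset[OF finW sub] by linarith
qed

theorem lemma3p1:
  fixes G :: "('a, 'b) pre_digraph" and n k :: nat
  assumes "graph G"
    and "n = card (verts G)"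
    and "k = adj_dim G"
  shows "n \<le> k + 2 ^ k"
proof -
  interpret graph G by fact
  obtain W where "adj_resolving G W" and "card W = adj_dim G"
    by (rule adj_dim_attained)
  then show ?thesis
    using card_verts_le_adj_resolving[of G W] finite_verts assms(2,3) by simp
qed

end
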